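(* Let $\mathcal F$ be a simple graph family with generating function $F(z,w)$, and let $\operatorname{SG}^{[\mathcal F]}_{n,m}$ be the number of pairs $(G,H)$ where $G$ is a simple graph with vertex set $\{1,\dots,n\}$ and $m$ edges and $H$ is an $\mathcal F$-subgraph of $G$. (i) For all $n,m$, \[ \operatorname{SG}^{[\mathcal F]}_{n,m} = n!\,[z^n w^m]\, F\!\left(z,\frac{w}{1+w}\right) e^{z}\,(1+w)^{\binom n2}. \] (ii) Assume $F(z,w)$ is entire in both variables. Let $D$ be an open set containing the closed unit disk. Let $n\to\infty$ and $m=m(n)\to\infty$ with $m=o(n^2)$ be such that $\frac{F(nz,\, mw/\binom n2)}{F(n,\, m/\binom n2)}$ converges uniformly on each compact subset of $D^2$ to an analytic function $L(z,w)$ on $D^2$. Then \[ \operatorname{SG}^{[\mathcal F]}_{n,m}\sim \binom{\binom n2}{m}\, F\!\left(n,\frac{m}{\binom n2}\right). \]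
   Context: A simple graph has a finite set of vertices labeled by distinct integers and a set of edges, each an unordered pair of distinct vertices (no loops, no multiple edges). An $(n,m)$-graph has vertex set $\{1,\dots,n\}$ and $m$ edges; there are $\binom{\binom n2}{m}$ of them. Isomorphism of graphs is the usual one (ignoring labels), and $F$ is a subgraph of $G$ if $V(F)\subset V(G)$ and $E(F)\subset E(G)$. A simple graph family $\mathcal F$ is a set of simple graphs with vertex labels $1,\dots,n(H)$, closed under isomorphism among such canonically labeled graphs; an $\mathcal F$-subgraph of $G$ is a subgraph isomorphic to an element of $\mathcal F$. The generating function of $\mathcal F$ is $F(z,w)=\sum_{H\in\mathcal F} w^{m(H)}\frac{z^{n(H)}}{n(H)!}$. *)

theory Defs
  imports
    "HOL-Analysis.Analysis"
    "HOL-Library.Landau_Symbols"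
    "HOL-Computational_Algebra.Formal_Power_Series"
begin

subsection \<open>Graphs\<close>

type_synonym 'a ugraph = "'a set \<times> 'a set set"

abbreviation gverts :: "'a ugraph \<Rightarrow> 'a set" where "gverts \<equiv> fst"
abbreviation gedges :: "'a ugraph \<Rightarrow> 'a set set" where "gedges \<equiv> snd"

definition simple_graph :: "'a ugraph \<Rightarrow> bool" where
  "simple_graph G \<longleftrightarrow>
     finite (gverts G) \<and> (\<forall>e\<in>gedges G. e \<subseteq> gverts G \<and> card e = 2)"

definition graph_iso :: "'a ugraph \<Rightarrow> 'b ugraph \<Rightarrow> bool" where
  "graph_iso G H \<longleftrightarrow>
     (\<exists>\<phi>. bij_betw \<phi> (gverts G) (gverts H) \<and> gedges H = (\<lambda>e. \<phi> ` e) ` gedges G)"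

definition is_subgraph :: "'a ugraph \<Rightarrow> 'a ugraph \<Rightarrow> bool" where
  "is_subgraph H G \<longleftrightarrow>
     simple_graph H \<and> simple_graph G \<and> gverts H \<subseteq> gverts G \<and> gedges H \<subseteq> gedges G"

definition nm_graphs :: "nat \<Rightarrow> nat \<Rightarrow> nat ugraph set" where
  "nm_graphs n m = {G. simple_graph G \<and> gverts G = {1..n} \<and> card (gedges G) = m}"

definition canonical_graph :: "nat ugraph \<Rightarrow> bool" where
  "canonical_graph H \<longleftrightarrow> simple_graph H \<and> gverts H = {1..card (gverts H)}"

definition simple_graph_family :: "nat ugraph set \<Rightarrow> bool" where
  "simple_graph_family \<F> \<longleftrightarrow>
     (\<forall>H\<in>\<F>. canonical_graph H) \<and>
     (\<forall>H\<in>\<F>. \<forall>H'. canonical_graph H' \<and> graph_iso H H' \<longrightarrow> H' \<in> \<F>)"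

definition family_subgraph :: "nat ugraph set \<Rightarrow> nat ugraph \<Rightarrow> nat ugraph \<Rightarrow> bool" where
  "family_subgraph \<F> H G \<longleftrightarrow> is_subgraph H G \<and> (\<exists>K\<in>\<F>. graph_iso H K)"

definition SG :: "nat ugraph set \<Rightarrow> nat \<Rightarrow> nat \<Rightarrow> nat" where
  "SG \<F> n m = card {(G, H). G \<in> nm_graphs n m \<and> family_subgraph \<F> H G}"


subsection \<open>Bivariate power series\<close>

text \<open>
  A formal power series in \<open>z\<close> and \<open>w\<close> is a series in \<open>z\<close> whose coefficients are
  series in \<open>w\<close>, so the coefficient of \<open>z^k w^l\<close> is \<open>fps_nth (fps_nth A k) l\<close>.
\<close>

type_synonym fps2 = "complex fps fps"

text \<open>
  The sum over the whole family is grouped by the number \<open>k\<close> of vertices. Each group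
  is a finite sum, since there are finitely many simple graphs on \<open>{1..k}\<close>.
\<close>

definition gen_fun :: "nat ugraph set \<Rightarrow> fps2" where
  "gen_fun \<F> = Abs_fps (\<lambda>k. \<Sum>H | H \<in> \<F> \<and> card (gverts H) = k.
     fps_X ^ card (gedges H) * fps_const (1 / fact k))"

text \<open>\<open>A(z, u(w))\<close>, for \<open>u\<close> without constant term\<close>

definition fps2_subst_w :: "fps2 \<Rightarrow> complex fps \<Rightarrow> fps2" where
  "fps2_subst_w A u = Abs_fps (\<lambda>k. fps_nth A k oo u)"

text \<open>\<open>fps_exp\<close> is not available here, as it needs a coefficient field.\<close>

definition fps2_exp_z :: fps2 where
  "fps2_exp_z = Abs_fps (\<lambda>k. fps_const (1 / fact k))"

definition fps2_term :: "fps2 \<Rightarrow> complex \<Rightarrow> complex \<Rightarrow> nat \<times> nat \<Rightarrow> complex" where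
  "fps2_term A z w = (\<lambda>(k, l). fps_nth (fps_nth A k) l * z ^ k * w ^ l)"

definition fps2_eval :: "fps2 \<Rightarrow> complex \<Rightarrow> complex \<Rightarrow> complex" where
  "fps2_eval A z w = (\<Sum>\<^sub>\<infinity>kl. fps2_term A z w kl)"

text \<open>
  A power series is entire if it converges at every point of \<open>\<complex>\<^sup>2\<close>
  (\<open>summable_on\<close> over the complex numbers is absolute convergence).
\<close>

definition fps2_entire :: "fps2 \<Rightarrow> bool" where
  "fps2_entire A \<longleftrightarrow> (\<forall>z w. fps2_term A z w summable_on UNIV)"

text \<open>Analyticity in two variables: local expansion into a convergent double power series\<close>

definition analytic2_on :: "(complex \<times> complex \<Rightarrow> complex) \<Rightarrow> (complex \<times> complex) set \<Rightarrow> bool" where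
  "analytic2_on f S \<longleftrightarrow>
     (\<forall>(z\<^sub>0, w\<^sub>0)\<in>S. \<exists>r>0. \<exists>a. \<forall>z\<in>ball z\<^sub>0 r. \<forall>w\<in>ball w\<^sub>0 r.
        (fps2_term a (z - z\<^sub>0) (w - w\<^sub>0) has_sum f (z, w)) UNIV)"

end

theory Submission imports Defs begin

text \<open>
  Write \<open>f(k,l)\<close> for the number of members of the family with \<open>k\<close> vertices and \<open>l\<close> edges, and
  \<open>N = n choose 2\<close>. Choosing the vertex set of the subgraph, its shape and then the remaining
  edges of the host graph gives
  \<open>SG(n,m) = (\<Sum>k l. (n choose k) f(k,l) (N - l choose m - l))\<close>, from which (i) is read off.

  For (ii) put \<open>q = m/N\<close>. The quotient of \<open>SG(n,m) / (N choose m)\<close> and \<open>F(n,q)\<close> is the mean of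
  a product of two ratios of falling factorials to powers, where \<open>(k,l)\<close> has weight
  proportional to \<open>f(k,l)/k! n^k q^l\<close>; this product lies between \<open>1 - k^2/n - l^2/m\<close> and \<open>1\<close>.
  As \<open>k^2\<close> and \<open>l^2\<close> are \<open>O(R^(k+l))\<close> for \<open>R > 1\<close>, the quotient differs from \<open>1\<close> by
  \<open>O(1/n + 1/m)\<close> times \<open>F(nR,qR) / F(n,q)\<close>. Taking \<open>R\<close> in \<open>D\<close>, the last factor is bounded,
  since it converges.
\<close>

section \<open>Counting\<close>

lemma card_supersets:
  assumes "finite U" "B \<subseteq> U"
  shows "card {E. B \<subseteq> E \<and> E \<subseteq> U \<and> card E = m} =
    (if card B \<le> m then (card U - card B) choose (m - card B) else 0)"
proof (cases "card B \<le> m")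
  case True
  have fB: "finite B" using assms finite_subset by blast
  have "bij_betw (\<lambda>E. E - B) {E. B \<subseteq> E \<and> E \<subseteq> U \<and> card E = m}
      {X. X \<subseteq> U - B \<and> card X = m - card B}"
  proof (rule bij_betw_byWitness[where f' = "\<lambda>X. X \<union> B"])
    show "(\<lambda>E. E - B) ` {E. B \<subseteq> E \<and> E \<subseteq> U \<and> card E = m}
        \<subseteq> {X. X \<subseteq> U - B \<and> card X = m - card B}"
      using fB by (auto simp: card_Diff_subset)
    show "(\<lambda>X. X \<union> B) ` {X. X \<subseteq> U - B \<and> card X = m - card B}
        \<subseteq> {E. B \<subseteq> E \<and> E \<subseteq> U \<and> card E = m}"
    proof clarsimp
      fix X assume X: "X \<subseteq> U - B" "card X = m - card B"
      then have "finite X" using assms by (meson finite_Diff finite_subset)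
      then have "card (X \<union> B) = card X + card B"
        using X fB by (intro card_Un_disjoint) auto
      then show "X \<subseteq> U \<and> B \<subseteq> U \<and> card (X \<union> B) = m" using X True assms by auto
    qed
  qed auto
  then have "card {E. B \<subseteq> E \<and> E \<subseteq> U \<and> card E = m} = card {X. X \<subseteq> U - B \<and> card X = m - card B}"
    by (rule bij_betw_same_card)
  also have "\<dots> = card (U - B) choose (m - card B)"
    using assms by (intro n_subsets) auto
  finally show ?thesis using True assms fB by (simp add: card_Diff_subset)
next
  case False
  have "{E. B \<subseteq> E \<and> E \<subseteq> U \<and> card E = m} = {}"
    using False assms by (auto dest: card_mono[OF finite_subset])
  then show ?thesis using False by (simp only: card.empty if_False)
qed

definition pairs :: "'a set \<Rightarrow> 'a set set" where
  "pairs V = {e. e \<subseteq> V \<and> card e = 2}"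

lemma finite_pairs: "finite V \<Longrightarrow> finite (pairs V)"
  unfolding pairs_def by simp

lemma card_pairs: "finite V \<Longrightarrow> card (pairs V) = card V choose 2"
  unfolding pairs_def by (rule n_subsets)

lemma pairs_mono: "V \<subseteq> W \<Longrightarrow> pairs V \<subseteq> pairs W"
  by (auto simp: pairs_def)

lemma simple_graph_iff: "simple_graph G \<longleftrightarrow> finite (gverts G) \<and> gedges G \<subseteq> pairs (gverts G)"
  by (auto simp: simple_graph_def pairs_def)

lemma card_gedges_le:
  assumes "simple_graph G"
  shows "card (gedges G) \<le> card (gverts G) choose 2"
  using assms card_mono[OF finite_pairs] by (metis card_pairs simple_graph_iff)

lemma finite_simple_graphs:
  assumes "finite V"
  shows "finite {G. simple_graph G \<and> gverts G \<subseteq> V}"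
proof (rule finite_subset)
  show "{G. simple_graph G \<and> gverts G \<subseteq> V} \<subseteq> Pow V \<times> Pow (pairs V)"
    using pairs_mono by (fastforce simp: simple_graph_iff)
qed (use assms finite_pairs in auto)

lemma finite_canonical_family:
  assumes "simple_graph_family \<F>"
  shows "finite {H. H \<in> \<F> \<and> card (gverts H) = k}"
  by (rule finite_subset[OF _ finite_simple_graphs[of "{1..k}"]])
    (use assms in \<open>auto simp: simple_graph_family_def canonical_graph_def\<close>)

lemma card_nm_graphs_containing:
  assumes "simple_graph H" "gverts H \<subseteq> {1..n}"
  shows "card {G \<in> nm_graphs n m. gedges H \<subseteq> gedges G} =
    (if card (gedges H) \<le> m
     then ((n choose 2) - card (gedges H)) choose (m - card (gedges H)) else 0)"
proof -
  let ?A = "{E. gedges H \<subseteq> E \<and> E \<subseteq> pairs {1..n} \<and> card E = m}"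
  have eq: "{G \<in> nm_graphs n m. gedges H \<subseteq> gedges G} = Pair {1..n} ` ?A"
  proof (intro equalityI subsetI)
    fix G assume "G \<in> {G \<in> nm_graphs n m. gedges H \<subseteq> gedges G}"
    then show "G \<in> Pair {1..n} ` ?A"
      by (intro image_eqI[where x = "gedges G"]) (auto simp: nm_graphs_def simple_graph_iff prod_eq_iff)
  qed (auto simp: nm_graphs_def simple_graph_iff)
  have "gedges H \<subseteq> pairs {1..n}"
    using assms pairs_mono[of "gverts H" "{1..n}"] by (auto simp: simple_graph_iff)
  then have "card ?A = (if card (gedges H) \<le> m
     then ((n choose 2) - card (gedges H)) choose (m - card (gedges H)) else 0)"
    using card_supersets[OF finite_pairs, of "{1..n}"] by (simp add: card_pairs)
  then show ?thesis unfolding eq by (subst card_image) (auto simp: inj_on_def)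
qed

section \<open>Relabelling\<close>

definition map_graph :: "('a \<Rightarrow> 'b) \<Rightarrow> 'a ugraph \<Rightarrow> 'b ugraph" where
  "map_graph \<phi> G = (\<phi> ` gverts G, (\<lambda>e. \<phi> ` e) ` gedges G)"

lemma gverts_map_graph [simp]: "gverts (map_graph \<phi> G) = \<phi> ` gverts G"
  and gedges_map_graph [simp]: "gedges (map_graph \<phi> G) = (\<lambda>e. \<phi> ` e) ` gedges G"
  by (auto simp: map_graph_def)

lemma simple_graph_map_graph:
  assumes "simple_graph G" "inj_on \<phi> (gverts G)"
  shows "simple_graph (map_graph \<phi> G)"
  using assms by (auto simp: simple_graph_def card_image inj_on_subset)

lemma card_gedges_map_graph:
  assumes "simple_graph G" "inj_on \<phi> (gverts G)"
  shows "card (gedges (map_graph \<phi> G)) = card (gedges G)"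
proof -
  have "inj_on (\<lambda>e. \<phi> ` e) (gedges G)"
    using assms by (intro inj_on_subset[OF inj_on_image_Pow]) (auto simp: simple_graph_def)
  then show ?thesis by (simp add: card_image)
qed

lemma graph_iso_map_graph:
  "inj_on \<phi> (gverts G) \<Longrightarrow> graph_iso G (map_graph \<phi> G)"
  by (auto simp: graph_iso_def bij_betw_def)

lemma graph_iso_iff_map_graph:
  "graph_iso G H \<longleftrightarrow> (\<exists>\<phi>. inj_on \<phi> (gverts G) \<and> H = map_graph \<phi> G)"
  by (auto simp: graph_iso_def bij_betw_def prod_eq_iff)

lemma map_graph_inverse:
  assumes "simple_graph G" "\<And>x. x \<in> gverts G \<Longrightarrow> \<psi> (\<phi> x) = x"
  shows "map_graph \<psi> (map_graph \<phi> G) = G"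
proof -
  have "\<psi> ` \<phi> ` e = e" if "e \<subseteq> gverts G" for e
    using that assms(2) by (force simp: image_image)
  moreover have "e \<subseteq> gverts G" if "e \<in> gedges G" for e
    using that assms(1) by (auto simp: simple_graph_def)
  ultimately show ?thesis by (simp add: prod_eq_iff image_image)
qed

lemma graph_iso_sym:
  assumes "simple_graph G" "graph_iso G H"
  shows "graph_iso H G"
proof -
  obtain \<phi> where \<phi>: "inj_on \<phi> (gverts G)" "H = map_graph \<phi> G"
    using assms by (auto simp: graph_iso_iff_map_graph)
  have "G = map_graph (inv_into (gverts G) \<phi>) H"
    using map_graph_inverse[OF assms(1), of "inv_into (gverts G) \<phi>" \<phi>] \<phi> by simp
  moreover have "inj_on (inv_into (gverts G) \<phi>) (gverts H)"
    using \<phi> by (simp add: inj_on_inv_into)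
  ultimately show ?thesis by (auto simp: graph_iso_iff_map_graph)
qed

lemma graph_iso_trans:
  assumes "graph_iso G H" "graph_iso H K"
  shows "graph_iso G K"
proof -
  obtain \<phi> \<psi> where "inj_on \<phi> (gverts G)" "H = map_graph \<phi> G" "inj_on \<psi> (gverts H)" "K = map_graph \<psi> H"
    using assms by (auto simp: graph_iso_iff_map_graph)
  then show ?thesis
    by (auto simp: graph_iso_iff_map_graph prod_eq_iff image_image comp_inj_on
        intro!: exI[where x = "\<psi> \<circ> \<phi>"])
qed

lemma sum_family_on_vertex_set:
  fixes g :: "nat \<Rightarrow> 'b::comm_monoid_add" and S :: "nat set"
  assumes \<F>: "simple_graph_family \<F>" and S: "finite S"
  shows "(\<Sum>H | simple_graph H \<and> gverts H = S \<and> (\<exists>K\<in>\<F>. graph_iso H K). g (card (gedges H))) =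
    (\<Sum>H | H \<in> \<F> \<and> card (gverts H) = card S. g (card (gedges H)))"
proof -
  obtain \<phi> where \<phi>: "bij_betw \<phi> S {1..card S}"
    using finite_same_card_bij[of S "{1..card S}"] S by auto
  define \<psi> where "\<psi> = inv_into S \<phi>"
  have \<psi>: "bij_betw \<psi> {1..card S} S" unfolding \<psi>_def using \<phi> by (rule bij_betw_inv_into)
  have \<psi>\<phi>: "\<psi> (\<phi> x) = x" if "x \<in> S" for x
    using that \<phi> unfolding \<psi>_def by (simp add: bij_betw_inv_into_left)
  have \<phi>\<psi>: "\<phi> (\<psi> x) = x" if "x \<in> {1..card S}" for x
    using that \<phi> unfolding \<psi>_def by (simp add: bij_betw_inv_into_right)
  have can: "simple_graph H" "gverts H = {1..card S}" if "H \<in> \<F>" "card (gverts H) = card S" for H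
    using that \<F> by (auto simp: simple_graph_family_def canonical_graph_def)
  show ?thesis
  proof (rule sum.reindex_bij_witness[where i = "map_graph \<psi>" and j = "map_graph \<phi>"])
    fix H assume "H \<in> {H. simple_graph H \<and> gverts H = S \<and> (\<exists>K\<in>\<F>. graph_iso H K)}"
    then obtain K where H: "simple_graph H" "gverts H = S" and K: "K \<in> \<F>" "graph_iso H K"
      by auto
    have inj: "inj_on \<phi> (gverts H)" using H \<phi> by (auto simp: bij_betw_def)
    show "map_graph \<psi> (map_graph \<phi> H) = H"
      using H \<psi>\<phi> by (intro map_graph_inverse) auto
    show "g (card (gedges (map_graph \<phi> H))) = g (card (gedges H))"
      using card_gedges_map_graph[OF H(1) inj] by simp
    have v: "gverts (map_graph \<phi> H) = {1..card S}" using \<phi> H by (simp add: bij_betw_def)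
    then have "canonical_graph (map_graph \<phi> H)"
      using simple_graph_map_graph[OF H(1) inj] by (simp add: canonical_graph_def)
    moreover have "graph_iso K (map_graph \<phi> H)"
      using graph_iso_trans graph_iso_sym graph_iso_map_graph H(1) K(2) inj by metis
    ultimately have "map_graph \<phi> H \<in> \<F>"
      using \<F> K(1) unfolding simple_graph_family_def by blast
    then show "map_graph \<phi> H \<in> {H. H \<in> \<F> \<and> card (gverts H) = card S}" using v by simp
  next
    fix H assume "H \<in> {H. H \<in> \<F> \<and> card (gverts H) = card S}"
    then have H: "H \<in> \<F>" "simple_graph H" "gverts H = {1..card S}" using can by auto
    have inj: "inj_on \<psi> (gverts H)" using H \<psi> by (auto simp: bij_betw_def)
    show "map_graph \<phi> (map_graph \<psi> H) = H"
      using H \<phi>\<psi> by (intro map_graph_inverse) auto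
    have "graph_iso (map_graph \<psi> H) H"
      using graph_iso_sym graph_iso_map_graph H inj by blast
    then show "map_graph \<psi> H \<in> {H. simple_graph H \<and> gverts H = S \<and> (\<exists>K\<in>\<F>. graph_iso H K)}"
      using H simple_graph_map_graph[OF H(2) inj] \<psi> by (auto simp: bij_betw_def)
  qed
qed

lemma SG_eq:
  assumes \<F>: "simple_graph_family \<F>"
  shows "SG \<F> n m = (\<Sum>k\<le>n. (n choose k) * (\<Sum>H | H \<in> \<F> \<and> card (gverts H) = k.
    if card (gedges H) \<le> m
    then ((n choose 2) - card (gedges H)) choose (m - card (gedges H)) else 0))"
proof -
  define g where "g l = (if l \<le> m then ((n choose 2) - l) choose (m - l) else 0)" for l
  define A where "A S = {H. simple_graph H \<and> gverts H = S \<and> (\<exists>K\<in>\<F>. graph_iso H K)}" for S :: "nat set"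
  define c where "c k = (\<Sum>H | H \<in> \<F> \<and> card (gverts H) = k. g (card (gedges H)))" for k
  let ?B = "\<lambda>H. {G \<in> nm_graphs n m. gedges H \<subseteq> gedges G}"
  have finA: "finite (A S)" if "S \<in> Pow {1..n}" for S
    by (rule finite_subset[OF _ finite_simple_graphs[of "{1..n}"]]) (use that in \<open>auto simp: A_def\<close>)
  have finB: "finite (?B H)" for H
    by (rule finite_subset[OF _ finite_simple_graphs[of "{1..n}"]]) (auto simp: nm_graphs_def)
  have eq: "{(G, H). G \<in> nm_graphs n m \<and> family_subgraph \<F> H G} =
      prod.swap ` (SIGMA H : (\<Union>S\<in>Pow {1..n}. A S). ?B H)"
    by (auto simp: A_def family_subgraph_def is_subgraph_def nm_graphs_def image_iff)
  have "SG \<F> n m = card (SIGMA H : (\<Union>S\<in>Pow {1..n}. A S). ?B H)"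
    unfolding SG_def eq by (subst card_image) auto
  also have "\<dots> = (\<Sum>H\<in>(\<Union>S\<in>Pow {1..n}. A S). card (?B H))"
    using finA finB by (intro card_SigmaI) auto
  also have "\<dots> = (\<Sum>S\<in>Pow {1..n}. \<Sum>H\<in>A S. card (?B H))"
    using finA by (intro sum.UNION_disjoint) (auto simp: A_def)
  also have "\<dots> = (\<Sum>S\<in>Pow {1..n}. \<Sum>H\<in>A S. g (card (gedges H)))"
    by (intro sum.cong refl) (auto simp: A_def g_def card_nm_graphs_containing)
  also have "\<dots> = (\<Sum>S\<in>Pow {1..n}. c (card S))"
    unfolding A_def c_def
    by (intro sum.cong refl sum_family_on_vertex_set[OF \<F>]) (auto intro: finite_subset)
  also have "\<dots> = (\<Sum>k\<le>n. \<Sum>S | S \<in> Pow {1..n} \<and> card S = k. c (card S))"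
    by (intro sum.group[symmetric]) (auto dest!: card_mono[rotated])
  also have "\<dots> = (\<Sum>k\<le>n. (n choose k) * c k)"
  proof (intro sum.cong refl)
    fix k
    have "(\<Sum>S | S \<in> Pow {1..n} \<and> card S = k. c (card S)) = (\<Sum>S | S \<subseteq> {1..n} \<and> card S = k. c k)"
      by (intro sum.cong) auto
    also have "\<dots> = (n choose k) * c k" by (simp add: n_subsets)
    finally show "(\<Sum>S | S \<in> Pow {1..n} \<and> card S = k. c (card S)) = (n choose k) * c k" .
  qed
  finally show ?thesis unfolding c_def g_def .
qed

section \<open>Coefficients\<close>

lemma fps_nth_gen_fun:
  assumes "simple_graph_family \<F>"
  shows "fps_nth (fps_nth (gen_fun \<F>) k) l =
    of_nat (card {H. H \<in> \<F> \<and> card (gverts H) = k \<and> card (gedges H) = l}) / fact k"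
proof -
  let ?A = "{H. H \<in> \<F> \<and> card (gverts H) = k}"
  have "fps_nth (fps_nth (gen_fun \<F>) k) l = (\<Sum>H\<in>?A. if card (gedges H) = l then 1 / fact k else 0)"
    by (auto simp: gen_fun_def fps_sum_nth intro!: sum.cong)
  also have "\<dots> = (\<Sum>H\<in>{H\<in>?A. card (gedges H) = l}. 1 / fact k)"
    by (intro sum.inter_filter[symmetric] finite_canonical_family assms)
  also have "{H\<in>?A. card (gedges H) = l} = {H. H \<in> \<F> \<and> card (gverts H) = k \<and> card (gedges H) = l}"
    by auto
  finally show ?thesis by simp
qed

lemma fps_nth_one_plus_X_power:
  "fps_nth ((1 + fps_X) ^ N) j = (of_nat (N choose j) :: 'a::comm_ring_1)"
proof (induction N arbitrary: j)
  case (Suc N)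
  then show ?case by (cases j) (auto simp: algebra_simps)
qed (auto simp: binomial_eq_0)

lemma fps_nth_substituted_power:
  assumes "l \<le> N"
  shows "fps_nth ((fps_X / (1 + fps_X)) ^ l * (1 + fps_X) ^ N :: complex fps) m =
    (if l \<le> m then of_nat ((N - l) choose (m - l)) else 0)"
proof -
  have "fps_X / (1 + fps_X) * (1 + fps_X :: complex fps) = fps_X"
    by (simp add: fps_divide_unit mult.assoc inverse_mult_eq_1)
  then have "(fps_X / (1 + fps_X)) ^ l * (1 + fps_X) ^ l = (fps_X ^ l :: complex fps)"
    by (metis power_mult_distrib)
  moreover have "(1 + fps_X) ^ N = ((1 + fps_X) ^ l * (1 + fps_X) ^ (N - l) :: complex fps)"
    using assms by (simp flip: power_add)
  ultimately have "(fps_X / (1 + fps_X)) ^ l * (1 + fps_X) ^ N =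
      (fps_X ^ l * (1 + fps_X) ^ (N - l) :: complex fps)"
    by (metis mult.assoc)
  then show ?thesis by (simp add: fps_X_power_mult_nth fps_nth_one_plus_X_power)
qed

lemma SG_eq_coefficient:
  assumes \<F>: "simple_graph_family \<F>"
  shows "of_nat (SG \<F> n m) = fact n * fps_nth (fps_nth
          (fps2_subst_w (gen_fun \<F>) (fps_X / (1 + fps_X)) * fps2_exp_z
             * fps_const ((1 + fps_X) ^ (n choose 2))) n) m"
proof -
  let ?u = "fps_X / (1 + fps_X) :: complex fps"
  let ?P = "(1 + fps_X) ^ (n choose 2) :: complex fps"
  define g where "g l = (if l \<le> m then ((n choose 2) - l) choose (m - l) else 0)" for l
  define A where "A k = {H. H \<in> \<F> \<and> card (gverts H) = k}" for k
  have u0: "fps_nth ?u 0 = 0" by (simp add: fps_divide_unit)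
  have summand: "fps_nth ((fps_nth (gen_fun \<F>) k oo ?u) * fps_const (1 / fact (n - k)) * ?P) m =
      (\<Sum>H\<in>A k. of_nat (g (card (gedges H)))) / (fact k * fact (n - k))" if "k \<le> n" for k
  proof -
    have "(fps_nth (gen_fun \<F>) k oo ?u) = (\<Sum>H\<in>A k. ?u ^ card (gedges H) * fps_const (1 / fact k))"
      using u0 by (simp add: gen_fun_def A_def fps_compose_sum_distrib fps_compose_mult_distrib
          fps_compose_power [symmetric])
    then have "(fps_nth (gen_fun \<F>) k oo ?u) * fps_const (1 / fact (n - k)) * ?P =
        (\<Sum>H\<in>A k. ?u ^ card (gedges H) * ?P * (fps_const (1 / fact k) * fps_const (1 / fact (n - k))))"
      by (simp only: sum_distrib_left sum_distrib_right mult_ac)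
    also have "fps_nth \<dots> m = (\<Sum>H\<in>A k. fps_nth (?u ^ card (gedges H) * ?P) m * (1 / fact k * (1 / fact (n - k))))"
      by (simp only: fps_sum_nth fps_const_mult fps_mult_right_const_nth)
    also have "\<dots> = (\<Sum>H\<in>A k. of_nat (g (card (gedges H))) / (fact k * fact (n - k)))"
    proof (intro sum.cong refl)
      fix H assume "H \<in> A k"
      then have "simple_graph H" "card (gverts H) = k"
        using \<F> by (auto simp: A_def simple_graph_family_def canonical_graph_def)
      then have "card (gedges H) \<le> n choose 2"
        using card_gedges_le[of H] binomial_mono[of k n] that
        by (metis binomial_right_mono le_trans)
      then show "fps_nth (?u ^ card (gedges H) * ?P) m * (1 / fact k * (1 / fact (n - k))) =
        of_nat (g (card (gedges H))) / (fact k * fact (n - k))"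
        by (simp add: fps_nth_substituted_power g_def)
    qed
    finally show ?thesis by (simp add: sum_divide_distrib)
  qed
  have "fact n * fps_nth (fps_nth (fps2_subst_w (gen_fun \<F>) ?u * fps2_exp_z * fps_const ?P) n) m =
      (\<Sum>k\<le>n. fact n * fps_nth ((fps_nth (gen_fun \<F>) k oo ?u) * fps_const (1 / fact (n - k)) * ?P) m)"
    by (simp only: fps_mult_right_const_nth)
      (simp add: fps_mult_nth[of _ "fps2_exp_z" n] fps_sum_nth sum_distrib_left sum_distrib_right
        atMost_atLeast0, simp add: fps2_subst_w_def fps2_exp_z_def)
  also have "\<dots> = (\<Sum>k\<le>n. of_nat (n choose k) * (\<Sum>H\<in>A k. of_nat (g (card (gedges H)))))"
    by (intro sum.cong refl) (simp add: summand binomial_fact)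
  also have "\<dots> = of_nat (SG \<F> n m)"
    unfolding SG_eq[OF \<F>] by (simp add: A_def g_def of_nat_sum of_nat_mult)
  finally show ?thesis by simp
qed

section \<open>Asymptotics\<close>

lemma prod_close_to_1:
  fixes t :: "nat \<Rightarrow> real"
  assumes "l \<le> m" "m > 0" and t: "\<And>j. j < l \<Longrightarrow> 1 - real j / real m \<le> t j \<and> t j \<le> 1"
  shows "1 - real (l\<^sup>2) / real m \<le> (\<Prod>j<l. t j)" "0 \<le> (\<Prod>j<l. t j)" "(\<Prod>j<l. t j) \<le> 1"
proof -
  have nn: "0 \<le> 1 - real j / real m" if "j < l" for j
    using that assms by (auto simp: field_simps)
  have "(\<Sum>j<l. real j / real m) \<le> (\<Sum>j<l. real l / real m)"
    by (intro sum_mono divide_right_mono) auto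
  then have "1 - real (l\<^sup>2) / real m \<le> 1 - (\<Sum>j<l. real j / real m)"
    by (simp add: power2_eq_square)
  also have "\<dots> \<le> (\<Prod>j<l. 1 - real j / real m)"
    using nn by (intro Weierstrass_prod_ineq) auto
  also have "\<dots> \<le> (\<Prod>j<l. t j)"
    using t nn by (intro prod_mono) auto
  finally show "1 - real (l\<^sup>2) / real m \<le> (\<Prod>j<l. t j)" .
  have "0 \<le> t j" if "j < l" for j
    using t[OF that] nn[OF that] by linarith
  then show "0 \<le> (\<Prod>j<l. t j)" "(\<Prod>j<l. t j) \<le> 1"
    using t by (auto intro!: prod_nonneg prod_le_1)
qed

lemma choose_ratio_eq:
  assumes "l \<le> m" "m \<le> N" "m > 0"
  shows "real ((N - l) choose (m - l)) / real (N choose m) * (real N / real m) ^ l =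
    (\<Prod>j<l. ((real m - real j) * real N) / ((real N - real j) * real m))"
  using assms(1)
proof (induction l)
  case 0
  then show ?case using assms by simp
next
  case (Suc l)
  have "(m - l) * ((N - l) choose (m - l)) = (N - l) * ((N - Suc l) choose (m - Suc l))"
    using times_binomial_minus1_eq[of "m - l" "N - l"] Suc.prems by simp
  then have "(real m - real l) * real ((N - l) choose (m - l)) =
      (real N - real l) * real ((N - Suc l) choose (m - Suc l))"
    using Suc.prems assms by (metis Suc_leD le_trans of_nat_diff of_nat_mult)
  then have "real ((N - Suc l) choose (m - Suc l)) =
      real ((N - l) choose (m - l)) * ((real m - real l) / (real N - real l))"
    using Suc.prems assms by (simp add: field_simps)
  then have "real ((N - Suc l) choose (m - Suc l)) / real (N choose m) * (real N / real m) ^ Suc l =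
      (real ((N - l) choose (m - l)) / real (N choose m) * (real N / real m) ^ l) *
      ((real m - real l) * real N / ((real N - real l) * real m))"
    by (simp add: mult_ac)
  then show ?case unfolding Suc.IH[OF Suc_leD[OF Suc.prems]] prod.lessThan_Suc .
qed

lemma choose_ratio_bounds:
  assumes "l \<le> m" "m \<le> N" "m > 0"
  defines "\<rho> \<equiv> real ((N - l) choose (m - l)) / real (N choose m) * (real N / real m) ^ l"
  shows "1 - real (l\<^sup>2) / real m \<le> \<rho>" "0 \<le> \<rho>" "\<rho> \<le> 1"
proof -
  have "1 - real j / real m \<le> ((real m - real j) * real N) / ((real N - real j) * real m) \<and>
      ((real m - real j) * real N) / ((real N - real j) * real m) \<le> 1" if "j < l" for j
  proof
    have pos: "real j < real m" "real m \<le> real N" "0 < real m" using that assms by auto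
    have "1 - real j / real m = (real m - real j) / real m * 1"
      using pos by (simp add: diff_divide_distrib)
    also have "\<dots> \<le> (real m - real j) / real m * (real N / (real N - real j))"
    proof (rule mult_left_mono)
      show "1 \<le> real N / (real N - real j)" using pos by (subst le_divide_eq_1_pos) auto
    qed (use pos in simp)
    also have "\<dots> = ((real m - real j) * real N) / ((real N - real j) * real m)"
      by (simp only: times_divide_times_eq mult.commute)
    finally show "1 - real j / real m \<le> ((real m - real j) * real N) / ((real N - real j) * real m)" .
    have "real j * real m \<le> real j * real N" using pos by (intro mult_left_mono) auto
    then show "((real m - real j) * real N) / ((real N - real j) * real m) \<le> 1"
      using pos by (subst divide_le_eq_1_pos) (auto simp: algebra_simps)
  qed
  note prod_close_to_1[OF assms(1,3) this]
  then show "1 - real (l\<^sup>2) / real m \<le> \<rho>" "0 \<le> \<rho>" "\<rho> \<le> 1"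
    unfolding \<rho>_def choose_ratio_eq[OF assms(1-3)] by auto
qed

lemma falling_ratio_bounds:
  assumes "k \<le> n" "n > 0"
  defines "\<rho> \<equiv> real (n choose k) * fact k / real n ^ k"
  shows "1 - real (k\<^sup>2) / real n \<le> \<rho>" "0 \<le> \<rho>" "\<rho> \<le> 1"
proof -
  have "real (n choose k) * fact k = (\<Prod>j<k. real n - real j)"
    using gbinomial_mult_fact'[of "real n" k] by (simp add: binomial_gbinomial atLeast0LessThan)
  then have "\<rho> = (\<Prod>j<k. (real n - real j) / real n)"
    by (simp add: \<rho>_def prod_dividef)
  also have "\<dots> = (\<Prod>j<k. 1 - real j / real n)"
    using assms by (simp add: diff_divide_distrib)
  finally have "\<rho> = (\<Prod>j<k. 1 - real j / real n)" .
  then show "1 - real (k\<^sup>2) / real n \<le> \<rho>" "0 \<le> \<rho>" "\<rho> \<le> 1"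
    using prod_close_to_1[OF assms(1,2), of "\<lambda>j. 1 - real j / real n"] by auto
qed

lemma square_le_exponential:
  fixes R :: real
  assumes "R > 1"
  obtains C where "C > 0" "\<And>k. real (k\<^sup>2) \<le> C * R ^ k"
proof -
  have "(\<lambda>k. real k / sqrt R ^ k) \<longlonglongrightarrow> 0"
    using lim_n_over_pown[of "sqrt R"] assms by simp
  then have "Bseq (\<lambda>k. real k / sqrt R ^ k)"
    by (intro convergent_imp_Bseq convergentI)
  then obtain B where B: "B > 0" "\<And>k. norm (real k / sqrt R ^ k) \<le> B"
    by (rule BseqE) blast
  have "real (k\<^sup>2) \<le> B\<^sup>2 * R ^ k" for k
  proof -
    have "real k \<le> B * sqrt R ^ k"
      using B(2)[of k] assms by (simp add: field_simps)
    then have "(real k)\<^sup>2 \<le> (B * sqrt R ^ k)\<^sup>2" by (intro power_mono) auto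
    also have "\<dots> = B\<^sup>2 * R ^ k"
      using assms by (simp add: power_mult_distrib flip: real_sqrt_power)
    finally show ?thesis by simp
  qed
  with B(1) that[of "B\<^sup>2"] show ?thesis by simp
qed

definition fcoeff :: "nat ugraph set \<Rightarrow> nat \<Rightarrow> nat \<Rightarrow> nat" where
  "fcoeff \<F> k l = card {H. H \<in> \<F> \<and> card (gverts H) = k \<and> card (gedges H) = l}"

definition fterm :: "nat ugraph set \<Rightarrow> real \<Rightarrow> real \<Rightarrow> nat \<times> nat \<Rightarrow> real" where
  "fterm \<F> x y = (\<lambda>(k, l). real (fcoeff \<F> k l) / fact k * x ^ k * y ^ l)"

lemma fterm_has_sum:
  assumes "simple_graph_family \<F>" "fps2_entire (gen_fun \<F>)"
  shows "(fterm \<F> x y has_sum infsum (fterm \<F> x y) UNIV) UNIV"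
    and "fps2_eval (gen_fun \<F>) (of_real x) (of_real y) = of_real (infsum (fterm \<F> x y) UNIV)"
proof -
  have eq: "fps2_term (gen_fun \<F>) (of_real x) (of_real y) = (\<lambda>p. of_real (fterm \<F> x y p))"
    by (auto simp: fps2_term_def fterm_def fcoeff_def fps_nth_gen_fun[OF assms(1)])
  have "(\<lambda>p. complex_of_real (fterm \<F> x y p)) summable_on UNIV"
    using assms(2) unfolding fps2_entire_def eq[symmetric] by blast
  then have "fterm \<F> x y summable_on UNIV"
    using summable_on_Re by fastforce
  then show *: "(fterm \<F> x y has_sum infsum (fterm \<F> x y) UNIV) UNIV" by simp
  show "fps2_eval (gen_fun \<F>) (of_real x) (of_real y) = of_real (infsum (fterm \<F> x y) UNIV)"
    unfolding fps2_eval_def eq by (rule infsumI[OF has_sum_of_real[OF *]])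
qed

lemma fterm_nonneg: "0 \<le> x \<Longrightarrow> 0 \<le> y \<Longrightarrow> 0 \<le> fterm \<F> x y p"
  by (auto simp: fterm_def split: prod.splits)

lemma infsum_fterm_pos:
  assumes "simple_graph_family \<F>" "fps2_entire (gen_fun \<F>)" "\<F> \<noteq> {}" "0 < x" "0 < y"
  shows "0 < infsum (fterm \<F> x y) UNIV"
proof -
  obtain H where H: "H \<in> \<F>" using assms by auto
  let ?p = "(card (gverts H), card (gedges H))"
  have "finite {K. K \<in> \<F> \<and> card (gverts K) = card (gverts H) \<and> card (gedges K) = card (gedges H)}"
    by (rule finite_subset[OF _ finite_canonical_family[OF assms(1), of "card (gverts H)"]]) auto
  then have "0 < fcoeff \<F> (card (gverts H)) (card (gedges H))"
    unfolding fcoeff_def card_gt_0_iff using H by blast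
  then have "0 < fterm \<F> x y ?p" using assms by (simp add: fterm_def)
  also have "fterm \<F> x y ?p \<le> infsum (fterm \<F> x y) UNIV"
  proof (rule has_sum_mono'[OF _ fterm_has_sum(1)[OF assms(1,2)]])
    show "(fterm \<F> x y has_sum fterm \<F> x y ?p) {?p}"
      using has_sum_finite[of "{?p}" "fterm \<F> x y"] by simp
  qed (use fterm_nonneg assms in auto)
  finally show ?thesis .
qed

lemma SG_eq_fcoeff:
  assumes \<F>: "simple_graph_family \<F>"
  shows "SG \<F> n m = (\<Sum>(k, l)\<in>{..n} \<times> {..m}.
    (n choose k) * (fcoeff \<F> k l * (((n choose 2) - l) choose (m - l))))"
proof -
  define g where "g l = ((n choose 2) - l) choose (m - l)" for l
  have "(\<Sum>H | H \<in> \<F> \<and> card (gverts H) = k. if card (gedges H) \<le> m then g (card (gedges H)) else 0)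
      = (\<Sum>l\<le>m. fcoeff \<F> k l * g l)" for k
  proof -
    let ?A = "{H. H \<in> \<F> \<and> card (gverts H) = k}"
    have "(\<Sum>H\<in>?A. if card (gedges H) \<le> m then g (card (gedges H)) else 0)
        = (\<Sum>H\<in>?A. \<Sum>l\<le>m. if card (gedges H) = l then g l else 0)"
      by (intro sum.cong refl) simp
    also have "\<dots> = (\<Sum>l\<le>m. \<Sum>H\<in>?A. if card (gedges H) = l then g l else 0)"
      by (rule sum.swap)
    also have "\<dots> = (\<Sum>l\<le>m. \<Sum>H\<in>{H\<in>?A. card (gedges H) = l}. g l)"
      by (intro sum.cong refl sum.inter_filter[symmetric] finite_canonical_family \<F>)
    finally show ?thesis by (simp add: fcoeff_def conj_assoc)
  qed
  then show ?thesis
    unfolding SG_eq[OF \<F>] g_def by (simp add: sum.cartesian_product sum_distrib_left)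
qed

lemma SG_error_bound:
  fixes R C :: real
  assumes \<F>: "simple_graph_family \<F>" "fps2_entire (gen_fun \<F>)"
    and "n > 0" "m > 0" "m \<le> n choose 2" "R > 1"
    and C: "\<And>k. real (k\<^sup>2) \<le> C * R ^ k"
  defines "q \<equiv> real m / real (n choose 2)"
  shows "\<bar>infsum (fterm \<F> (real n) q) UNIV - real (SG \<F> n m) / real ((n choose 2) choose m)\<bar>
    \<le> C * (1 / real n + 1 / real m) * infsum (fterm \<F> (real n * R) (q * R)) UNIV"
proof -
  define N where "N = n choose 2"
  define \<rho> where "\<rho> = (\<lambda>(k, l). if k \<le> n \<and> l \<le> m then (real (n choose k) * fact k / real n ^ k) *
      (real ((N - l) choose (m - l)) / real (N choose m) * (real N / real m) ^ l) else 0)"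
  let ?T = "fterm \<F> (real n) q" and ?TR = "fterm \<F> (real n * R) (q * R)"
  have mN: "m \<le> N" using assms by (simp add: N_def)
  then have N: "N > 0" "N choose m > 0" using \<open>m > 0\<close> by auto
  have q: "q > 0" using \<open>m > 0\<close> N by (simp add: q_def flip: N_def)
  have "((\<lambda>p. ?T p * \<rho> p) has_sum (real (SG \<F> n m) / real (N choose m))) UNIV"
  proof (rule has_sum_finite_neutralI[where B = "{..n} \<times> {..m}"])
    show "real (SG \<F> n m) / real (N choose m) = (\<Sum>p\<in>{..n} \<times> {..m}. ?T p * \<rho> p)"
      unfolding SG_eq_fcoeff[OF \<F>(1)] of_nat_sum sum_divide_distrib
      using \<open>n > 0\<close> \<open>m > 0\<close> N
      by (intro sum.cong refl) (auto simp: fterm_def \<rho>_def q_def power_divide simp flip: N_def)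
  qed (auto simp: \<rho>_def split: if_splits)
  then have diff: "((\<lambda>p. ?T p - ?T p * \<rho> p) has_sum
      (infsum ?T UNIV - real (SG \<F> n m) / real (N choose m))) UNIV"
    using has_sum_add[OF fterm_has_sum(1)[OF \<F>] has_sum_uminusI] by (simp only: diff_conv_add_uminus)
  have bound: "0 \<le> 1 - \<rho> (k, l) \<and> 1 - \<rho> (k, l) \<le> real (k\<^sup>2) / real n + real (l\<^sup>2) / real m" for k l
  proof (cases "k \<le> n \<and> l \<le> m")
    case True
    define a where "a = real (n choose k) * fact k / real n ^ k"
    define b where "b = real ((N - l) choose (m - l)) / real (N choose m) * (real N / real m) ^ l"
    have a: "1 - real (k\<^sup>2) / real n \<le> a" "0 \<le> a" "a \<le> 1"
      unfolding a_def using True assms falling_ratio_bounds by auto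
    have b: "1 - real (l\<^sup>2) / real m \<le> b" "0 \<le> b" "b \<le> 1"
      unfolding b_def using True assms choose_ratio_bounds[of l m N] by (auto simp: N_def)
    have "0 \<le> (1 - a) * (1 - b)" "a * b \<le> 1" using a b by (auto intro: mult_le_one)
    moreover have "\<rho> (k, l) = a * b" using True by (simp add: \<rho>_def a_def b_def)
    ultimately show ?thesis using a b by (simp add: algebra_simps)
  next
    case False
    have large: "1 \<le> real (i\<^sup>2) / real j" if "j < i" "0 < j" for i j :: nat
    proof -
      have "j \<le> i * i" using that by (metis le_square less_imp_le le_trans)
      then show ?thesis using that by (simp add: power2_eq_square flip: of_nat_mult)
    qed
    have "1 \<le> real (k\<^sup>2) / real n \<or> 1 \<le> real (l\<^sup>2) / real m"
      using False large assms by (meson not_le)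
    moreover have "0 \<le> real (k\<^sup>2) / real n" "0 \<le> real (l\<^sup>2) / real m" by auto
    moreover have "\<rho> (k, l) = 0" unfolding \<rho>_def prod.case if_not_P[OF False] ..
    ultimately show ?thesis by linarith
  qed
  have "0 \<le> infsum ?T UNIV - real (SG \<F> n m) / real (N choose m)"
  proof (rule has_sum_nonneg[OF diff])
    fix p :: "nat \<times> nat"
    have "0 \<le> ?T p * (1 - \<rho> p)"
      using bound[of "fst p" "snd p"] fterm_nonneg[of "real n" q] q by (intro mult_nonneg_nonneg) auto
    then show "0 \<le> ?T p - ?T p * \<rho> p" by (simp add: algebra_simps)
  qed
  moreover have "infsum ?T UNIV - real (SG \<F> n m) / real (N choose m) \<le>
      C * (1 / real n + 1 / real m) * infsum ?TR UNIV"
  proof (rule has_sum_mono[OF diff has_sum_cmult_right[OF fterm_has_sum(1)[OF \<F>]]])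
    fix p :: "nat \<times> nat"
    obtain k l where p: "p = (k, l)" by (cases p)
    have C0: "C \<ge> 0" using C[of 0] by simp
    have "real (k\<^sup>2) \<le> C * (R ^ k * R ^ l)"
      using order_trans[OF C[of k]] mult_left_mono[of 1 "R ^ l" "C * R ^ k"] C0 \<open>R > 1\<close>
      by (simp add: mult.assoc)
    moreover have "real (l\<^sup>2) \<le> C * (R ^ k * R ^ l)"
      using order_trans[OF C[of l]] mult_left_mono[of 1 "R ^ k" "C * R ^ l"] C0 \<open>R > 1\<close>
      by (simp add: mult_ac)
    ultimately have "real (k\<^sup>2) / real n + real (l\<^sup>2) / real m \<le>
        C * (R ^ k * R ^ l) / real n + C * (R ^ k * R ^ l) / real m"
      by (intro add_mono divide_right_mono) auto
    then have "1 - \<rho> p \<le> C * (1 / real n + 1 / real m) * (R ^ k * R ^ l)"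
      using bound[of k l] unfolding p by (simp add: algebra_simps)
    then have "?T p * (1 - \<rho> p) \<le> ?T p * (C * (1 / real n + 1 / real m) * (R ^ k * R ^ l))"
      using fterm_nonneg q by (intro mult_left_mono) auto
    also have "\<dots> = C * (1 / real n + 1 / real m) * ?TR p"
      by (simp add: p fterm_def power_mult_distrib mult_ac)
    finally show "?T p - ?T p * \<rho> p \<le> C * (1 / real n + 1 / real m) * ?TR p"
      by (simp add: algebra_simps)
  qed
  ultimately show ?thesis unfolding N_def by simp
qed

lemma eventually_le_choose_2:
  assumes "(\<lambda>n. real (m n)) \<in> o(\<lambda>n. real n ^ 2)"
  shows "eventually (\<lambda>n. m n \<le> n choose 2) sequentially"
proof -
  have "eventually (\<lambda>n. norm (real (m n)) \<le> 1 / 4 * norm ((real n)\<^sup>2)) sequentially"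
    using landau_o.smallD[OF assms, of "1 / 4"] by simp
  then show ?thesis
    using eventually_ge_at_top[of 2]
  proof eventually_elim
    case (elim n)
    have "real (n choose 2) = ((real n)\<^sup>2 - real n) / 2"
      using elim by (simp add: choose_two real_of_nat_div of_nat_diff power2_eq_square algebra_simps)
    moreover have "real n * 2 \<le> (real n)\<^sup>2"
      unfolding power2_eq_square using elim by (intro mult_left_mono) auto
    moreover have "real (m n) \<le> (real n)\<^sup>2 / 4" using elim(1) by simp
    ultimately have "real (m n) \<le> real (n choose 2)" by argo
    then show ?case by simp
  qed
qed

theorem theorem5p2:
  fixes \<F> :: "nat ugraph set" and F :: fps2
  assumes "simple_graph_family \<F>" and "F = gen_fun \<F>"
  shows
    "(\<forall>n m. of_nat (SG \<F> n m) =
        fact n * fps_nth (fps_nth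
          (fps2_subst_w F (fps_X / (1 + fps_X)) * fps2_exp_z
             * fps_const ((1 + fps_X) ^ (n choose 2))) n) m)
     \<and>
     (\<forall>(D :: complex set) (L :: complex \<times> complex \<Rightarrow> complex) (m :: nat \<Rightarrow> nat).
        fps2_entire F \<longrightarrow>
        open D \<longrightarrow> cball 0 1 \<subseteq> D \<longrightarrow>
        filterlim m at_top at_top \<longrightarrow>
        (\<lambda>n. real (m n)) \<in> o(\<lambda>n. real n ^ 2) \<longrightarrow>
        analytic2_on L (D \<times> D) \<longrightarrow>
        (\<forall>K. compact K \<and> K \<subseteq> D \<times> D \<longrightarrow>
           uniform_limit K
             (\<lambda>n (z, w).
                fps2_eval F (of_nat n * z) (of_nat (m n) * w / of_nat (n choose 2))
                / fps2_eval F (of_nat n) (of_nat (m n) / of_nat (n choose 2)))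
             L sequentially) \<longrightarrow>
        (\<lambda>n. of_nat (SG \<F> n (m n)))
          \<sim>[sequentially]
        (\<lambda>n. of_nat ((n choose 2) choose m n)
              * fps2_eval F (of_nat n) (of_nat (m n) / of_nat (n choose 2))))"
proof (intro conjI allI impI)
  show "of_nat (SG \<F> n m) =
        fact n * fps_nth (fps_nth
          (fps2_subst_w F (fps_X / (1 + fps_X)) * fps2_exp_z
             * fps_const ((1 + fps_X) ^ (n choose 2))) n) m" for n m
    using SG_eq_coefficient assms by blast
next
  fix D :: "complex set" and L :: "complex \<times> complex \<Rightarrow> complex" and m :: "nat \<Rightarrow> nat"
  assume ent: "fps2_entire F" and D: "open D" "cball 0 1 \<subseteq> D"
    and m_top: "filterlim m at_top at_top" and m_small: "(\<lambda>n. real (m n)) \<in> o(\<lambda>n. real n ^ 2)"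
    and lim: "\<forall>K. compact K \<and> K \<subseteq> D \<times> D \<longrightarrow> uniform_limit K
             (\<lambda>n (z, w).
                fps2_eval F (of_nat n * z) (of_nat (m n) * w / of_nat (n choose 2))
                / fps2_eval F (of_nat n) (of_nat (m n) / of_nat (n choose 2)))
             L sequentially"
  note \<F> = assms(1) ent[unfolded assms(2)]
  define q where "q n = real (m n) / real (n choose 2)" for n
  define \<Phi> where "\<Phi> n r = infsum (fterm \<F> (real n * r) (q n * r)) UNIV" for n r
  have eval: "fps2_eval F (of_nat n * of_real r) (of_nat (m n) * of_real r / of_nat (n choose 2))
      = of_real (\<Phi> n r)" for n r
    using fterm_has_sum(2)[OF \<F>, of "real n * r" "q n * r"] by (simp add: assms(2) \<Phi>_def q_def)
  note eval1 = eval[of _ 1, simplified]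
  show "(\<lambda>n. of_nat (SG \<F> n (m n))) \<sim>[sequentially]
      (\<lambda>n. of_nat ((n choose 2) choose m n)
         * fps2_eval F (of_nat n) (of_nat (m n) / of_nat (n choose 2)))"
  proof (cases "\<F> = {}")
    case True
    then have "SG \<F> n (m n) = 0" "\<Phi> n 1 = 0" for n
      by (auto simp: SG_def family_subgraph_def \<Phi>_def fterm_def fcoeff_def intro!: infsum_0)
    then show ?thesis by (simp add: eval1)
  next
    case False
    obtain e where e: "e > 0" "ball 1 e \<subseteq> D"
      using D openE[of D 1] by (metis centre_in_cball mem_cball_0 norm_one order_refl subsetD)
    define R where "R = 1 + e / 2"
    have R: "R > 1" "complex_of_real R \<in> D"
      using e by (auto simp: R_def dist_norm intro!: subsetD[OF e(2)])
    obtain C where C: "C > 0" "\<And>k. real (k\<^sup>2) \<le> C * R ^ k"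
      using square_le_exponential[OF R(1)] by blast
    have "(\<lambda>n. complex_of_real (\<Phi> n R) / of_real (\<Phi> n 1)) \<longlonglongrightarrow> L (of_real R, of_real R)"
      using lim[rule_format, of "{(of_real R, of_real R)}"] R by (simp add: eval eval1)
    then have "Bseq (\<lambda>n. complex_of_real (\<Phi> n R) / of_real (\<Phi> n 1))"
      by (intro convergent_imp_Bseq convergentI)
    then obtain B where B: "\<And>n. norm (complex_of_real (\<Phi> n R) / of_real (\<Phi> n 1)) \<le> B"
      by (rule BseqE) blast
    have "(\<lambda>n. real (SG \<F> n (m n)) / (real ((n choose 2) choose m n) * \<Phi> n 1)) \<longlonglongrightarrow> 1"
    proof (rule LIM_zero_cancel, rule Lim_null_comparison)
      have "filterlim (\<lambda>n. real (m n)) at_top sequentially"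
        by (rule filterlim_compose[OF filterlim_real_sequentially m_top])
      then have "(\<lambda>n. 1 / real (m n)) \<longlonglongrightarrow> 0"
        by (intro real_tendsto_divide_at_top[OF tendsto_const])
      then have "(\<lambda>n. C * (1 / real n + 1 / real (m n)) * B) \<longlonglongrightarrow> C * (0 + 0) * B"
        by (intro tendsto_intros lim_1_over_n)
      then show "(\<lambda>n. C * (1 / real n + 1 / real (m n)) * B) \<longlonglongrightarrow> 0" by simp
      have "eventually (\<lambda>n. m n > 0) sequentially"
        using eventually_compose_filterlim[OF eventually_gt_at_top m_top] .
      then show "eventually (\<lambda>n. norm (real (SG \<F> n (m n)) / (real ((n choose 2) choose m n) * \<Phi> n 1) - 1)
          \<le> C * (1 / real n + 1 / real (m n)) * B) sequentially"
        using eventually_le_choose_2[OF m_small] eventually_gt_at_top[of 0]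
      proof eventually_elim
        case (elim n)
        let ?S = "real (SG \<F> n (m n)) / real ((n choose 2) choose m n)"
        have "0 < real (n choose 2)" using elim by linarith
        then have \<Phi>1: "\<Phi> n 1 > 0"
          unfolding \<Phi>_def q_def using elim
          by (intro infsum_fterm_pos \<F> False mult_pos_pos divide_pos_pos) auto
        have "\<bar>\<Phi> n 1 - ?S\<bar> \<le> C * (1 / real n + 1 / real (m n)) * \<Phi> n R"
          using SG_error_bound[OF \<F> _ _ _ R(1) C(2), of n "m n"] elim by (simp add: \<Phi>_def q_def)
        then have "\<bar>?S - \<Phi> n 1\<bar> / \<Phi> n 1 \<le> C * (1 / real n + 1 / real (m n)) * (\<Phi> n R / \<Phi> n 1)"
          using \<Phi>1 by (simp add: divide_right_mono abs_minus_commute)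
        also have "\<dots> \<le> C * (1 / real n + 1 / real (m n)) * B"
        proof (intro mult_left_mono)
          have "norm (complex_of_real (\<Phi> n R) / of_real (\<Phi> n 1)) = \<bar>\<Phi> n R / \<Phi> n 1\<bar>"
            by (simp add: norm_divide)
          then show "\<Phi> n R / \<Phi> n 1 \<le> B" using B[of n] by linarith
        qed (use C in auto)
        also have "\<bar>?S - \<Phi> n 1\<bar> / \<Phi> n 1 = \<bar>?S / \<Phi> n 1 - 1\<bar>"
        proof -
          have "?S / \<Phi> n 1 - 1 = (?S - \<Phi> n 1) / \<Phi> n 1"
            using \<Phi>1 by (simp add: diff_divide_distrib)
          then show ?thesis using \<Phi>1 by (simp only: abs_divide abs_of_pos)
        qed
        finally show ?case by simp
      qed
    qed
    then have "(\<lambda>n. complex_of_real (real (SG \<F> n (m n)) / (real ((n choose 2) choose m n) * \<Phi> n 1))) \<longlonglongrightarrow> of_real 1"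
      by (rule tendsto_of_real)
    then show ?thesis
      by (intro asymp_equivI') (simp add: eval1)
  qed
qed

end
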